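(* Let $\mathfrak{SC}$ be a sequent calculus having the structural rules of weakening and contraction (left and right). Suppose that $$(\mathrm r)\quad\frac{\{\Gamma_i\Rightarrow\Delta_i\}_{1\le i\le n}}{\Gamma\Rightarrow\Delta}$$ is a rule of $\mathfrak{SC}$ and that there are sets of formulas $\Gamma'_i$ and $\Delta'_i$, for $1\le i\le n$, such that: (i) $\Gamma'_i\subseteq\Gamma_i$ and $\Delta'_i\subseteq\Delta_i$; (ii) the sequent $\Gamma'_i\Rightarrow\Delta'_i$ is derivable in $\mathfrak{SC}$ from $\Gamma_i\Rightarrow\Delta_i$ without using the rule $(\mathrm r)$ nor the cut rule. Then $(\mathrm r)$ can be replaced by $$(\mathrm r')\quad\frac{\{\Gamma'_i\Rightarrow\Delta'_i\}_{1\le i\le n}}{\Gamma\Rightarrow\Delta}.$$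
   Context: Sequents are ordinary two-sided sequents $\Gamma\Rightarrow\Delta$ with $\Gamma,\Delta$ finite (possibly empty) sets of formulas; rules are given by schemes, with the upper sequents as premises and the lower sequent as conclusion. "$(\mathrm r)$ can be replaced by $(\mathrm r')$" means that the two rules are equivalent over the rest of the calculus: $(\mathrm r')$ is derivable in $\mathfrak{SC}$, and $(\mathrm r)$ is derivable in the calculus obtained from $\mathfrak{SC}$ by deleting $(\mathrm r)$ and adding $(\mathrm r')$; in particular the two calculi prove the same sequents. A rule is derivable in a calculus if (for each instance) its conclusion can be derived from its premises using the axioms and rules of that calculus. *)

theory Defs
  imports Main "HOL-Library.FSet"
begin

datatype 'f sequent = Sequent (antecedent: "'f fset") (succedent: "'f fset")
  (infix \<open>\<Rrightarrow>\<close> 45)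

text \<open>
  A rule is identified with the set of its instances, each a pair of a list of premises and a
  conclusion. Initial sequents (axioms) are rules all of whose instances have no premises.
  A calculus is a set of rules, not a set of instances: deleting a rule from it keeps all the
  other rules intact, even those sharing some instances with the deleted one.
\<close>

type_synonym 'f rule = "('f sequent list \<times> 'f sequent) set"
type_synonym 'f calculus = "'f rule set"

inductive derivable :: "'f calculus \<Rightarrow> 'f sequent set \<Rightarrow> 'f sequent \<Rightarrow> bool"
  for C :: "'f calculus" and H :: "'f sequent set" where
  hyp: "S \<in> H \<Longrightarrow> derivable C H S"
| inference: "R \<in> C \<Longrightarrow> (Ps, S) \<in> R \<Longrightarrow> (\<And>P. P \<in> set Ps \<Longrightarrow> derivable C H P) \<Longrightarrow> derivable C H S"

definition derivable_rule :: "'f calculus \<Rightarrow> 'f rule \<Rightarrow> bool" where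
  "derivable_rule C R \<longleftrightarrow> (\<forall>(Ps, S) \<in> R. derivable C (set Ps) S)"

definition replaceable :: "'f calculus \<Rightarrow> 'f rule \<Rightarrow> 'f rule \<Rightarrow> bool" where
  "replaceable C R R' \<longleftrightarrow> derivable_rule C R' \<and> derivable_rule (insert R' (C - {R})) R"

text \<open>
  The rule given by a scheme with \<open>n\<close> premises, numbered from 1. The elements of \<open>I\<close> are the
  admissible instantiations of the scheme, i.e. the assignments of concrete formulas and finite
  sets of formulas to its schematic letters that meet its side conditions (if any);
  \<open>P i \<sigma>\<close> and \<open>S \<sigma>\<close> are the \<open>i\<close>-th premise and the conclusion under the instantiation \<open>\<sigma>\<close>.
\<close>

definition scheme :: "'i set \<Rightarrow> nat \<Rightarrow> (nat \<Rightarrow> 'i \<Rightarrow> 'f sequent) \<Rightarrow> ('i \<Rightarrow> 'f sequent) \<Rightarrow> 'f rule" where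
  "scheme I n P S = {(map (\<lambda>i. P i \<sigma>) [1..<Suc n], S \<sigma>) | \<sigma>. \<sigma> \<in> I}"

definition weakening_left :: "'f rule" where
  "weakening_left = {([\<Gamma> \<Rrightarrow> \<Delta>], finsert A \<Gamma> \<Rrightarrow> \<Delta>) | \<Gamma> \<Delta> A. True}"

definition weakening_right :: "'f rule" where
  "weakening_right = {([\<Gamma> \<Rrightarrow> \<Delta>], \<Gamma> \<Rrightarrow> finsert A \<Delta>) | \<Gamma> \<Delta> A. True}"

text \<open>Since the sides of a sequent are sets, premise and conclusion of a contraction coincide.\<close>

definition contraction_left :: "'f rule" where
  "contraction_left = {([finsert A (finsert A \<Gamma>) \<Rrightarrow> \<Delta>], finsert A \<Gamma> \<Rrightarrow> \<Delta>) | \<Gamma> \<Delta> A. True}"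

definition contraction_right :: "'f rule" where
  "contraction_right = {([\<Gamma> \<Rrightarrow> finsert A (finsert A \<Delta>)], \<Gamma> \<Rrightarrow> finsert A \<Delta>) | \<Gamma> \<Delta> A. True}"

text \<open>The cut rule in its two customary forms, with shared and with independent contexts.\<close>

definition cut_shared :: "'f rule" where
  "cut_shared = {([\<Gamma> \<Rrightarrow> finsert A \<Delta>, finsert A \<Gamma> \<Rrightarrow> \<Delta>], \<Gamma> \<Rrightarrow> \<Delta>) | \<Gamma> \<Delta> A. True}"

definition cut_independent :: "'f rule" where
  "cut_independent =
     {([\<Gamma> \<Rrightarrow> finsert A \<Delta>, finsert A \<Pi> \<Rrightarrow> \<Lambda>], \<Gamma> |\<union>| \<Pi> \<Rrightarrow> \<Delta> |\<union>| \<Lambda>) | \<Gamma> \<Delta> \<Pi> \<Lambda> A. True}"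

definition cut_rules :: "'f rule set" where
  "cut_rules = {cut_shared, cut_independent}"

lemma derivable_trans:
  "derivable C H S \<Longrightarrow> (\<And>P. P \<in> H \<Longrightarrow> derivable C K P) \<Longrightarrow> derivable C K S"
  by (induction rule: derivable.induct) (auto intro: derivable.inference)

lemma derivable_by_derivable_rules:
  assumes "derivable C H S" and "\<And>R. R \<in> C \<Longrightarrow> derivable_rule D R"
  shows "derivable D H S"
  using assms(1)
proof (induction rule: derivable.induct)
  case (inference R Ps S)
  then have "derivable D (set Ps) S"
    using assms(2)[of R] by (auto simp: derivable_rule_def)
  then show ?case
    using inference.IH by (rule derivable_trans)
qed (rule derivable.hyp)

lemma derivable_rule_member: "R \<in> C \<Longrightarrow> derivable_rule C R"
  by (auto simp: derivable_rule_def intro: derivable.intros)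

lemma replaceable_same_derivable:
  assumes "replaceable C R R'"
  shows "derivable (insert R' (C - {R})) H S \<longleftrightarrow> derivable C H S"
proof
  assume "derivable (insert R' (C - {R})) H S"
  then show "derivable C H S"
    by (rule derivable_by_derivable_rules)
      (use assms in \<open>auto simp: replaceable_def intro: derivable_rule_member\<close>)
next
  assume "derivable C H S"
  then show "derivable (insert R' (C - {R})) H S"
  proof (rule derivable_by_derivable_rules)
    fix Q assume "Q \<in> C"
    then show "derivable_rule (insert R' (C - {R})) Q"
      using assms by (cases "Q = R") (auto simp: replaceable_def intro: derivable_rule_member)
  qed
qed

end

theory Submission
  imports Defs
begin

text \<open>
  Both halves of the equivalence have the same shape: two schemes with the same conclusion are
  compared by deriving, instance by instance, each premise of the one in the calculus from the
  corresponding premise of the other (\<open>derivable_rule_scheme_if_premises_derivable\<close>). From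
  \<open>\<Gamma>'\<^sub>i \<Rrightarrow> \<Delta>'\<^sub>i\<close> one reaches the larger sequent \<open>\<Gamma>\<^sub>i \<Rrightarrow> \<Delta>\<^sub>i\<close> by weakening
  (\<open>derivable_weakening\<close>), so \<open>r'\<close> is derivable with \<open>r\<close>. Conversely, the assumed derivation
  of \<open>\<Gamma>'\<^sub>i \<Rrightarrow> \<Delta>'\<^sub>i\<close> from \<open>\<Gamma>\<^sub>i \<Rrightarrow> \<Delta>\<^sub>i\<close> avoids \<open>r\<close>, so it survives the deletion of \<open>r\<close>, and
  \<open>r\<close> is derivable with \<open>r'\<close>.
\<close>

lemma derivable_mono: "derivable C H S \<Longrightarrow> C \<subseteq> D \<Longrightarrow> derivable D H S"
  by (erule derivable_by_derivable_rules) (auto intro: derivable_rule_member)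

lemma derivable_weakening:
  assumes "weakening_left \<in> C" "weakening_right \<in> C"
    and "derivable C H (\<Gamma> \<Rrightarrow> \<Delta>)" "\<Gamma> |\<subseteq>| \<Gamma>'" "\<Delta> |\<subseteq>| \<Delta>'"
  shows "derivable C H (\<Gamma>' \<Rrightarrow> \<Delta>')"
proof -
  have left: "derivable C H (\<Pi> |\<union>| \<Gamma> \<Rrightarrow> \<Delta>)" for \<Pi>
  proof (induction \<Pi>)
    case (insert A \<Pi>)
    have "([\<Pi> |\<union>| \<Gamma> \<Rrightarrow> \<Delta>], finsert A \<Pi> |\<union>| \<Gamma> \<Rrightarrow> \<Delta>) \<in> weakening_left"
      by (auto simp: weakening_left_def)
    then show ?case
      using insert.IH by (auto intro: derivable.inference[OF assms(1)])
  qed (simp add: assms(3))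
  have "derivable C H (\<Gamma>' \<Rrightarrow> \<Lambda> |\<union>| \<Delta>)" for \<Lambda>
  proof (induction \<Lambda>)
    case empty
    show ?case
      using left[of \<Gamma>'] assms(4) by (simp add: sup_absorb1)
  next
    case (insert A \<Lambda>)
    have "([\<Gamma>' \<Rrightarrow> \<Lambda> |\<union>| \<Delta>], \<Gamma>' \<Rrightarrow> finsert A \<Lambda> |\<union>| \<Delta>) \<in> weakening_right"
      by (auto simp: weakening_right_def)
    then show ?case
      using insert.IH by (auto intro: derivable.inference[OF assms(2)])
  qed
  from this[of \<Delta>'] show ?thesis
    using assms(5) by (simp add: sup_absorb1)
qed

lemma derivable_rule_scheme_if_premises_derivable:
  assumes "scheme I n Q S \<in> C"
    and PQ: "\<And>i \<sigma>. i \<in> {1..n} \<Longrightarrow> \<sigma> \<in> I \<Longrightarrow> derivable C {P i \<sigma>} (Q i \<sigma>)"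
  shows "derivable_rule C (scheme I n P S)"
proof -
  have "derivable C (set (map (\<lambda>i. P i \<sigma>) [1..<Suc n])) (S \<sigma>)" if \<sigma>: "\<sigma> \<in> I" for \<sigma>
  proof (rule derivable.inference[OF assms(1)])
    show "(map (\<lambda>i. Q i \<sigma>) [1..<Suc n], S \<sigma>) \<in> scheme I n Q S"
      using \<sigma> by (auto simp: scheme_def)
  next
    fix X assume "X \<in> set (map (\<lambda>i. Q i \<sigma>) [1..<Suc n])"
    then obtain i where i: "i \<in> {1..n}" and X: "X = Q i \<sigma>"
      by (force simp: less_Suc_eq_le simp del: upt_Suc)
    show "derivable C (set (map (\<lambda>i. P i \<sigma>) [1..<Suc n])) X"
      unfolding X using PQ[OF i \<sigma>]
      by (rule derivable_trans) (use i in \<open>auto intro!: derivable.hyp simp del: upt_Suc\<close>)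
  qed
  then show ?thesis
    unfolding derivable_rule_def scheme_def[of I n P S] by blast
qed

theorem proposition5p4:
  fixes SC :: "'f calculus"
    and r r' :: "'f rule"
    and I :: "'i set"
    and n :: nat
    and \<Gamma>i \<Delta>i \<Gamma>i' \<Delta>i' :: "nat \<Rightarrow> 'i \<Rightarrow> 'f fset"
    and \<Gamma> \<Delta> :: "'i \<Rightarrow> 'f fset"
  assumes weakening: "weakening_left \<in> SC" "weakening_right \<in> SC"
    and contraction: "contraction_left \<in> SC" "contraction_right \<in> SC"
    and r: "r = scheme I n (\<lambda>i \<sigma>. \<Gamma>i i \<sigma> \<Rrightarrow> \<Delta>i i \<sigma>) (\<lambda>\<sigma>. \<Gamma> \<sigma> \<Rrightarrow> \<Delta> \<sigma>)"
    and r_in_SC: "r \<in> SC"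
    and r': "r' = scheme I n (\<lambda>i \<sigma>. \<Gamma>i' i \<sigma> \<Rrightarrow> \<Delta>i' i \<sigma>) (\<lambda>\<sigma>. \<Gamma> \<sigma> \<Rrightarrow> \<Delta> \<sigma>)"
    and subsets: "\<And>i \<sigma>. i \<in> {1..n} \<Longrightarrow> \<sigma> \<in> I \<Longrightarrow> \<Gamma>i' i \<sigma> |\<subseteq>| \<Gamma>i i \<sigma> \<and> \<Delta>i' i \<sigma> |\<subseteq>| \<Delta>i i \<sigma>"
    and derivability: "\<And>i \<sigma>. i \<in> {1..n} \<Longrightarrow> \<sigma> \<in> I \<Longrightarrow>
      derivable (SC - ({r} \<union> cut_rules)) {\<Gamma>i i \<sigma> \<Rrightarrow> \<Delta>i i \<sigma>} (\<Gamma>i' i \<sigma> \<Rrightarrow> \<Delta>i' i \<sigma>)"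
  shows "replaceable SC r r'"
  unfolding replaceable_def
proof
  have "derivable SC {\<Gamma>i' i \<sigma> \<Rrightarrow> \<Delta>i' i \<sigma>} (\<Gamma>i i \<sigma> \<Rrightarrow> \<Delta>i i \<sigma>)"
    if "i \<in> {1..n}" "\<sigma> \<in> I" for i \<sigma>
  proof (rule derivable_weakening[OF weakening])
    show "derivable SC {\<Gamma>i' i \<sigma> \<Rrightarrow> \<Delta>i' i \<sigma>} (\<Gamma>i' i \<sigma> \<Rrightarrow> \<Delta>i' i \<sigma>)"
      by (simp add: derivable.hyp)
  qed (use subsets[OF that] in auto)
  then show "derivable_rule SC r'"
    unfolding r' by (rule derivable_rule_scheme_if_premises_derivable[OF r_in_SC[unfolded r]])
next
  let ?SC' = "insert r' (SC - {r})"
  have "derivable ?SC' {\<Gamma>i i \<sigma> \<Rrightarrow> \<Delta>i i \<sigma>} (\<Gamma>i' i \<sigma> \<Rrightarrow> \<Delta>i' i \<sigma>)"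
    if "i \<in> {1..n}" "\<sigma> \<in> I" for i \<sigma>
    using derivability[OF that] by (rule derivable_mono) auto
  moreover have "scheme I n (\<lambda>i \<sigma>. \<Gamma>i' i \<sigma> \<Rrightarrow> \<Delta>i' i \<sigma>) (\<lambda>\<sigma>. \<Gamma> \<sigma> \<Rrightarrow> \<Delta> \<sigma>) \<in> ?SC'"
    by (simp add: r')
  ultimately have "derivable_rule ?SC' (scheme I n (\<lambda>i \<sigma>. \<Gamma>i i \<sigma> \<Rrightarrow> \<Delta>i i \<sigma>) (\<lambda>\<sigma>. \<Gamma> \<sigma> \<Rrightarrow> \<Delta> \<sigma>))"
    by (intro derivable_rule_scheme_if_premises_derivable)
  then show "derivable_rule ?SC' r"
    by (simp only: r)
qed

end
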